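(* Let $K_n$ be the complete graph on $n$ vertices and let $H$ be a finite simple connected graph with $|V_H|=m$. Then $$W(K_n\wr H)=n^3m^{2n-2}W(H)+\frac{nm^n}{2}\big(n^2m^n-n^2m^{n-1}-m^nn+2m^{n-1}n-m+m^n-m^{n-1}\big).$$
   Context: The wreath product $G\wr H$ has vertex set $\{(f,v): f:V_G\to V_H,\ v\in V_G\}$; $(f,v)$ and $(f',v')$ are adjacent iff either $v=v'$, $f(w)=f'(w)$ for $w\neq v$ and $f(v)\sim f'(v)$ in $H$, or $f=f'$ and $v\sim v'$ in $G$. The Wiener index of a connected graph $X$ is $W(X)=\frac12\sum_{u,v\in V_X}d_X(u,v)$, $d_X$ the geodesic distance. Throughout, $n\ge 2$. *)

theory Defs
  imports "Graph_Theory.Graph_Theory" "HOL-Library.FuncSet"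
begin

text \<open>
  Finite simple graphs are the symmetric loop-free pair digraphs of the locale \<^locale>\<open>pair_graph\<close>.
\<close>

definition gdist :: "('a, 'b) pre_digraph \<Rightarrow> 'a \<Rightarrow> 'a \<Rightarrow> real" where
  "gdist X u v = real_of_ereal (wf_digraph.\<mu> X (\<lambda>_. 1) u v)"

text \<open>
  The sum ranges over ordered pairs; every edge of a simple graph is a pair of opposite arcs, so
  walks along arcs are exactly walks along edges.
\<close>

definition wiener_index :: "('a, 'b) pre_digraph \<Rightarrow> real" where
  "wiener_index X = 1 / 2 * (\<Sum>u \<in> verts X. \<Sum>v \<in> verts X. gdist X u v)"

text \<open>
  The functions from the vertices of \<open>G\<close> to those of \<open>H\<close> are taken to be extensional, so
  that equality of functions is equality on the vertices of \<open>G\<close>.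
\<close>

definition wreath_verts ::
  "'a pair_pre_digraph \<Rightarrow> 'b pair_pre_digraph \<Rightarrow> (('a \<Rightarrow> 'b) \<times> 'a) set" where
  "wreath_verts G H = (pverts G \<rightarrow>\<^sub>E pverts H) \<times> pverts G"

definition wreath_product ::
  "'a pair_pre_digraph \<Rightarrow> 'b pair_pre_digraph \<Rightarrow> (('a \<Rightarrow> 'b) \<times> 'a) pair_pre_digraph" where
  "wreath_product G H =
    \<lparr> pverts = wreath_verts G H,
      parcs = {((f, v), (f', v')) | f v f' v'.
        (f, v) \<in> wreath_verts G H \<and> (f', v') \<in> wreath_verts G H \<and>
        ((v = v' \<and> (\<forall>w \<in> pverts G. w \<noteq> v \<longrightarrow> f w = f' w) \<and> (f v, f' v) \<in> parcs H) \<or>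
         (f = f' \<and> (v, v') \<in> parcs G))} \<rparr>"

lemma gdist_eq_Least:
  assumes "wf_digraph X" and "u \<rightarrow>\<^sup>*\<^bsub>X\<^esub> v"
  shows "gdist X u v = real (LEAST k. \<exists>p. pre_digraph.awalk X u p v \<and> length p = k)"
proof -
  interpret wf_digraph X by fact
  let ?P = "\<lambda>k. \<exists>p. awalk u p v \<and> length p = k"
  have cost: "awalk_cost (\<lambda>_. 1) p = real (length p)" for p
    by (induction p) auto
  from assms(2) have "\<exists>k. ?P k" by (auto simp: reachable_awalk)
  then have "?P (Least ?P)" by (rule LeastI_ex)
  then obtain p where p: "awalk u p v" "length p = Least ?P" by blast
  have "\<mu> (\<lambda>_. 1) u v = ereal (real (Least ?P))"
    unfolding \<mu>_def
  proof (rule antisym)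
    show "(INF p\<in>{p. awalk u p v}. ereal (awalk_cost (\<lambda>_. 1) p)) \<le> ereal (real (Least ?P))"
      by (rule INF_lower2[where i = p]) (use p in \<open>auto simp: cost\<close>)
  next
    show "ereal (real (Least ?P)) \<le> (INF p\<in>{p. awalk u p v}. ereal (awalk_cost (\<lambda>_. 1) p))"
      by (rule INF_greatest) (auto simp: cost intro!: Least_le)
  qed
  then show ?thesis by (simp add: gdist_def)
qed

lemma pair_graph_wreath_product:
  assumes "pair_graph G" and "pair_graph H"
  shows "pair_graph (wreath_product G H)"
proof -
  interpret G: pair_graph G by fact
  interpret H: pair_graph H by fact
  have fin: "finite (wreath_verts G H)"
    unfolding wreath_verts_def by (intro finite_cartesian_product finite_PiE) auto
  have sub: "parcs (wreath_product G H) \<subseteq> wreath_verts G H \<times> wreath_verts G H"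
    by (auto simp: wreath_product_def)
  have symG: "(b, a) \<in> parcs G" if "(a, b) \<in> parcs G" for a b
    using G.arcs_symmetric that by blast
  have symH: "(b, a) \<in> parcs H" if "(a, b) \<in> parcs H" for a b
    using H.arcs_symmetric that by blast
  have sy: "sym (parcs (wreath_product G H))"
    unfolding sym_def by (auto simp: wreath_product_def intro: symG symH)
  show ?thesis
  proof
    show "finite (parcs (wreath_product G H))"
      by (rule finite_subset[OF sub]) (simp add: fin)
    show "symmetric (with_proj (wreath_product G H))"
      using sy by (simp add: symmetric_def)
  qed (use fin sub in \<open>auto simp: wreath_product_def dest: G.no_loops' H.no_loops'\<close>)
qed

end

theory Submission
  imports Defs
begin

text \<open>
  The distance from \<open>(f, v)\<close> to \<open>(f', v')\<close> in the wreath product is the sum over \<open>w\<close> of the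
  distances from \<open>f w\<close> to \<open>f' w\<close> in \<open>H\<close>, plus the length of a shortest walk in \<open>K\<close> from \<open>v\<close> to \<open>v'\<close>
  through all \<open>w\<close> with \<open>f w \<noteq> f' w\<close>. This quantity drops by at most one along every arc, and by
  exactly one along a suitable arc, so it is the distance. Summing it over all pairs of vertices
  reduces to sums over single coordinates of \<open>f\<close> and \<open>f'\<close>, except for the extra step of the closed
  walks \<open>v = v'\<close>, which is not needed when \<open>f\<close> and \<open>f'\<close> agree off \<open>v\<close>.
\<close>

section \<open>Distances recognised by potential functions\<close>

text \<open>By \<open>lipschitz\<close>, no walk from \<open>x\<close> to \<open>t\<close> is
  shorter than \<open>\<phi> x\<close>. By \<open>descent\<close>, following arcs that lower \<phi>
  by one ends at \<open>t\<close> after exactly \<open>\<phi> x\<close> steps, which also shows that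
  \<open>t\<close> is reachable.\<close>

lemma gdist_eq_potential:
  fixes \<phi> :: "'a \<Rightarrow> nat"
  assumes "wf_digraph X" and "t \<in> verts X" and "u \<in> verts X"
    and zero: "\<phi> t = 0"
    and lipschitz: "\<And>e. e \<in> arcs X \<Longrightarrow> \<phi> (tail X e) \<le> Suc (\<phi> (head X e))"
    and descent: "\<And>x. x \<in> verts X \<Longrightarrow> x \<noteq> t \<Longrightarrow>
      \<exists>e \<in> arcs X. tail X e = x \<and> \<phi> x = Suc (\<phi> (head X e))"
  shows "gdist X u t = real (\<phi> u)"
proof -
  interpret wf_digraph X by fact
  have lower: "\<phi> x \<le> length p" if "awalk x p t" for x p
    using that
  proof (induction p arbitrary: x)
    case Nil
    then show ?case by (simp add: awalk_Nil_iff zero)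
  next
    case (Cons e p)
    then have "e \<in> arcs X" "x = tail X e" "\<phi> (head X e) \<le> length p"
      by (auto simp: awalk_Cons_iff)
    with lipschitz[of e] show ?case by simp
  qed
  have upper: "\<exists>p. awalk x p t \<and> length p = \<phi> x" if "x \<in> verts X" for x
    using that
  proof (induction "\<phi> x" arbitrary: x)
    case 0
    then have "x = t" using descent[of x] by auto
    then show ?case using \<open>t \<in> verts X\<close> zero by (auto simp: awalk_Nil_iff intro: exI[of _ "[]"])
  next
    case (Suc k)
    then have "x \<noteq> t" using zero by auto
    with descent Suc.prems obtain e
      where e: "e \<in> arcs X" "tail X e = x" "\<phi> x = Suc (\<phi> (head X e))" by blast
    with Suc.hyps(1)[of "head X e"] Suc.hyps(2) obtain p
      where "awalk (head X e) p t" "length p = \<phi> (head X e)" by auto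
    with e show ?case by (intro exI[of _ "e # p"]) (auto simp: awalk_Cons_iff)
  qed
  from upper[OF \<open>u \<in> verts X\<close>] obtain p where p: "awalk u p t" "length p = \<phi> u" by blast
  then have "(LEAST k. \<exists>p. awalk u p t \<and> length p = k) = \<phi> u"
    by (intro Least_equality) (use lower in auto)
  moreover have "u \<rightarrow>\<^sup>*\<^bsub>X\<^esub> t" using p(1) by (auto simp: reachable_awalk)
  ultimately show ?thesis using gdist_eq_Least[OF \<open>wf_digraph X\<close>] by simp
qed

section \<open>Distances as natural numbers\<close>

text \<open>On reachable pairs this is \<open>gdist\<close> by \<open>gdist_eq_Least\<close>; being
  of type \<open>nat\<close>, it can serve as part of a potential.\<close>

definition hop_dist :: "('a, 'b) pre_digraph \<Rightarrow> 'a \<Rightarrow> 'a \<Rightarrow> nat" where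
  "hop_dist X u v = (LEAST k. \<exists>p. pre_digraph.awalk X u p v \<and> length p = k)"

context wf_digraph
begin

lemma hop_dist_le: "awalk u p v \<Longrightarrow> hop_dist G u v \<le> length p"
  unfolding hop_dist_def by (rule Least_le) blast

lemma hop_dist_awalk:
  assumes "u \<rightarrow>\<^sup>* v"
  obtains p where "awalk u p v" "length p = hop_dist G u v"
proof -
  have "\<exists>k p. awalk u p v \<and> length p = k" using assms by (simp add: reachable_awalk)
  then have "\<exists>p. awalk u p v \<and> length p = hop_dist G u v"
    unfolding hop_dist_def by (rule LeastI_ex)
  then show ?thesis using that by blast
qed

lemma hop_dist_self: "u \<in> verts G \<Longrightarrow> hop_dist G u u = 0"
  using hop_dist_le[of u "[]" u] by (simp add: awalk_Nil_iff)

lemma hop_dist_arc: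
  assumes "e \<in> arcs G" "head G e \<rightarrow>\<^sup>* v"
  shows "hop_dist G (tail G e) v \<le> Suc (hop_dist G (head G e) v)"
proof -
  obtain p where "awalk (head G e) p v" "length p = hop_dist G (head G e) v"
    using hop_dist_awalk assms(2) by blast
  with assms(1) hop_dist_le[of "tail G e" "e # p" v] show ?thesis by (simp add: awalk_Cons_iff)
qed

text \<open>Take the first arc of a shortest walk. The remaining walk is again shortest, since
  \<open>hop_dist_arc\<close> forbids a drop of more than one.\<close>

lemma hop_dist_descent:
  assumes "u \<rightarrow>\<^sup>* v" "u \<noteq> v"
  obtains e where "e \<in> arcs G" "tail G e = u" "hop_dist G u v = Suc (hop_dist G (head G e) v)"
proof -
  obtain p where p: "awalk u p v" "length p = hop_dist G u v"
    using hop_dist_awalk assms(1) by blast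
  with assms(2) obtain e q where "p = e # q" by (cases p) (auto simp: awalk_Nil_iff)
  with p have e: "e \<in> arcs G" "tail G e = u" "awalk (head G e) q v" "Suc (length q) = hop_dist G u v"
    by (auto simp: awalk_Cons_iff)
  moreover have "hop_dist G (head G e) v \<le> length q" using e(3) by (rule hop_dist_le)
  moreover have "hop_dist G u v \<le> Suc (hop_dist G (head G e) v)"
    using hop_dist_arc[of e v] e by (auto simp: reachable_awalk)
  ultimately show ?thesis using that[of e] by linarith
qed

end

section \<open>Walks in a complete graph through prescribed vertices\<close>

definition disagree :: "'a set \<Rightarrow> ('a \<Rightarrow> 'b) \<Rightarrow> ('a \<Rightarrow> 'b) \<Rightarrow> 'a set" where
  "disagree A f f' = {w \<in> A. f w \<noteq> f' w}"

text \<open>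
  The length of a shortest walk in a complete graph from \<open>v\<close> to \<open>v'\<close> that visits all of \<open>D\<close>.
\<close>

definition tour :: "'a \<Rightarrow> 'a \<Rightarrow> 'a set \<Rightarrow> nat" where
  "tour v v' D = card (D - {v, v'}) + of_bool (v \<noteq> v' \<or> \<not> D \<subseteq> {v, v'})"

text \<open>Leaving \<open>v\<close> for \<open>u\<close> can remove only \<open>u\<close> from the
  vertices still to be visited. The case \<open>u = v'\<close> is separate because only there can
  the extra step be absent from \<open>tour u v' D\<close>.\<close>

lemma tour_arc:
  assumes "finite D"
  shows "tour v v' D \<le> Suc (tour u v' D)"
proof (cases "u = v'")
  case True
  have "card (D - {v, v'}) \<le> card (D - {v'})" by (rule card_mono) (use assms in auto)
  moreover have "D - {v'} \<noteq> {}" if "\<not> D \<subseteq> {v, v'}" using that by auto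
  ultimately show ?thesis using True by (auto simp: tour_def)
next
  case False
  have "card (D - {v, v'}) \<le> card (insert u (D - {u, v'}))"
    by (rule card_mono) (use assms in auto)
  also have "\<dots> \<le> Suc (card (D - {u, v'}))" by (simp add: card_insert_if assms)
  finally show ?thesis using False by (auto simp: tour_def)
qed

text \<open>Going to \<open>w\<close> removes exactly \<open>w\<close> from the vertices still to be
  visited, and the \<open>of_bool\<close> term is 1 both before and after the move.\<close>

lemma tour_step:
  assumes "finite D" "v \<notin> D" "w \<in> D" "w \<noteq> v'"
  shows "tour v v' D = Suc (tour w v' D)"
proof -
  have eq: "D - {v, v'} = insert w (D - {w, v'})" using assms by auto
  have "card (D - {v, v'}) = Suc (card (D - {w, v'}))"
    unfolding eq using assms(1) by simp
  then show ?thesis using assms by (auto simp: tour_def)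
qed

section \<open>Distances in the wreath product\<close>

locale wreath_complete =
  fixes K :: "'a pair_pre_digraph" and H :: "'b pair_pre_digraph"
  assumes graph_K: "pair_graph K" and graph_H: "pair_graph H"
    and arcs_K: "parcs K = {(u, v). u \<in> pverts K \<and> v \<in> pverts K \<and> u \<noteq> v}"
    and strong_H: "strongly_connected (with_proj H)"
begin

sublocale H: pair_graph H by (rule graph_H)

lemma finite_K: "finite (pverts K)"
  using graph_K by (simp add: pair_graph_def pair_digraph_def pair_fin_digraph_def pair_fin_digraph_axioms_def)

lemma reachable_H: "x \<in> pverts H \<Longrightarrow> y \<in> pverts H \<Longrightarrow> x \<rightarrow>\<^sup>*\<^bsub>with_proj H\<^esub> y"
  using strong_H by (auto simp: strongly_connected_def)

text \<open>The right-hand side, as a function \<phi> of the starting vertex, is a potential for the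
  target \<open>(f', v')\<close>. An arc inside a copy of \<open>H\<close> alters only one summand
  of the distance sum, and an arc of \<open>K\<close> alters only the tour term.\<close>

lemma gdist_wreath:
  assumes "(f, v) \<in> wreath_verts K H" and "(f', v') \<in> wreath_verts K H"
  shows "gdist (with_proj (wreath_product K H)) (f, v) (f', v') =
    (\<Sum>w \<in> pverts K. gdist (with_proj H) (f w) (f' w)) + real (tour v v' (disagree (pverts K) f f'))"
proof -
  let ?A = "pverts K" and ?X = "with_proj (wreath_product K H)"
  let ?d = "hop_dist (with_proj H)"
  define \<phi> where "\<phi> = (\<lambda>(g, u). (\<Sum>w \<in> ?A. ?d (g w) (f' w)) + tour u v' (disagree ?A g f'))"
  have f': "f' w \<in> pverts H" if "w \<in> ?A" for w
    using assms(2) that by (auto simp: wreath_verts_def)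
  interpret X: pair_graph "wreath_product K H"
    by (rule pair_graph_wreath_product[OF graph_K graph_H])
  have fin: "finite (disagree ?A g f')" for g by (simp add: disagree_def finite_K)
  have upd: "(\<Sum>w \<in> ?A. ?d (g w) (f' w)) = ?d (g u) (f' u) + (\<Sum>w \<in> ?A - {u}. ?d (g w) (f' w))"
    if "u \<in> ?A" for g u
    using finite_K that by (rule sum.remove)
  \<comment> \<open>A tour starting at \<open>u\<close> does not depend on whether \<open>u\<close>
    lies in the set to be visited, so changing \<open>g\<close> at \<open>u\<close> leaves the tour
    term fixed.\<close>
  have tour_cong: "tour u v' (disagree ?A g f') = tour u v' (disagree ?A g' f')"
    if "\<And>w. w \<in> ?A \<Longrightarrow> w \<noteq> u \<Longrightarrow> g w = g' w" for g g' u
  proof -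
    have "disagree ?A g f' - {u, v'} = disagree ?A g' f' - {u, v'}"
      using that by (auto simp: disagree_def)
    moreover from this have "disagree ?A g f' \<subseteq> {u, v'} \<longleftrightarrow> disagree ?A g' f' \<subseteq> {u, v'}"
      by blast
    ultimately show ?thesis by (simp only: tour_def)
  qed
  have "gdist ?X (f, v) (f', v') = real (\<phi> (f, v))"
  proof (rule gdist_eq_potential)
    show "wf_digraph ?X" ..
    show "(f', v') \<in> verts ?X" "(f, v) \<in> verts ?X"
      using assms by (simp_all add: wreath_product_def)
    show "\<phi> (f', v') = 0"
      using f' by (simp add: \<phi>_def tour_def disagree_def H.hop_dist_self)
  next
    fix e assume "e \<in> arcs ?X"
    then obtain g u g' u' where e: "e = ((g, u), (g', u'))"
      and verts: "(g, u) \<in> wreath_verts K H" "(g', u') \<in> wreath_verts K H"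
      and "(u = u' \<and> (\<forall>w \<in> ?A. w \<noteq> u \<longrightarrow> g w = g' w) \<and> (g u, g' u) \<in> parcs H) \<or>
         (g = g' \<and> (u, u') \<in> parcs K)"
      by (auto simp: wreath_product_def)
    then consider
      (lamp) "u = u'" "\<And>w. w \<in> ?A \<Longrightarrow> w \<noteq> u \<Longrightarrow> g w = g' w" "(g u, g' u) \<in> parcs H"
      | (move) "g = g'" by blast
    then show "\<phi> (tail ?X e) \<le> Suc (\<phi> (head ?X e))"
    proof cases
      case lamp
      have u: "u \<in> ?A" using verts by (auto simp: wreath_verts_def)
      have "g' u \<in> pverts H" using lamp(3) H.in_arcsD2 by blast
      then have "?d (g u) (f' u) \<le> Suc (?d (g' u) (f' u))"
        using H.hop_dist_arc[of "(g u, g' u)" "f' u"] lamp(3) reachable_H f' u by auto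
      moreover have "(\<Sum>w \<in> ?A - {u}. ?d (g w) (f' w)) = (\<Sum>w \<in> ?A - {u}. ?d (g' w) (f' w))"
        using lamp(2) by (intro sum.cong) auto
      ultimately show ?thesis
        using upd[OF u, of g] upd[OF u, of g'] tour_cong[of u g g'] lamp(1,2)
        by (simp add: e \<phi>_def)
    next
      case move
      then show ?thesis using tour_arc[OF fin, of u v' g u'] by (simp add: e \<phi>_def)
    qed
  next
    fix x assume "x \<in> verts ?X" and ne: "x \<noteq> (f', v')"
    then obtain g u where x: "x = (g, u)" and g: "g \<in> ?A \<rightarrow>\<^sub>E pverts H" and u: "u \<in> ?A"
      by (auto simp: wreath_product_def wreath_verts_def)
    have v': "v' \<in> ?A" using assms(2) by (simp add: wreath_verts_def)
    \<comment> \<open>Completeness of \<open>K\<close> makes every such move an arc; it keeps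
      \<open>g\<close>, so only the tour term has to drop.\<close>
    have jump: "\<exists>e \<in> arcs ?X. tail ?X e = x \<and> \<phi> x = Suc (\<phi> (head ?X e))"
      if "w \<in> ?A" "w \<noteq> u" "tour u v' (disagree ?A g f') = Suc (tour w v' (disagree ?A g f'))" for w
      using that g u
      by (intro bexI[of _ "((g, u), (g, w))"])
        (auto simp: x \<phi>_def wreath_product_def wreath_verts_def arcs_K)
    \<comment> \<open>An optimal strategy: correct the value at the current vertex first, then visit
      the other vertices of disagreement, leaving \<open>v'\<close> to the end.\<close>
    consider (lamp) "g u \<noteq> f' u"
      | (visit) w where "g u = f' u" "w \<in> disagree ?A g f'" "w \<noteq> v'"
      | (home) "g u = f' u" "disagree ?A g f' \<subseteq> {v'}" by blast
    then show "\<exists>e \<in> arcs ?X. tail ?X e = x \<and> \<phi> x = Suc (\<phi> (head ?X e))"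
    proof cases
      case lamp
      have "g u \<in> pverts H" using g u by auto
      with lamp f'[OF u] obtain y where y: "(g u, y) \<in> parcs H"
        and dy: "?d (g u) (f' u) = Suc (?d y (f' u))"
        using H.hop_dist_descent[OF reachable_H] by (metis prod.collapse)
      let ?g = "g(u := y)"
      have "y \<in> pverts H" using y H.in_arcsD2 by blast
      then have g': "?g \<in> ?A \<rightarrow>\<^sub>E pverts H" using g u by auto
      have "(\<Sum>w \<in> ?A - {u}. ?d (g w) (f' w)) = (\<Sum>w \<in> ?A - {u}. ?d (?g w) (f' w))"
        by (intro sum.cong) auto
      then have "\<phi> (g, u) = Suc (\<phi> (?g, u))"
        using upd[OF u, of g] upd[OF u, of ?g] tour_cong[of u g ?g] dy by (simp add: \<phi>_def)
      moreover have "((g, u), (?g, u)) \<in> arcs ?X"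
        using g g' u y by (simp add: wreath_product_def wreath_verts_def)
      ultimately show ?thesis by (intro bexI[of _ "((g, u), (?g, u))"]) (simp_all add: x)
    next
      case visit
      then have "w \<in> ?A" "w \<noteq> u" "u \<notin> disagree ?A g f'" by (auto simp: disagree_def)
      with jump tour_step[OF fin] visit show ?thesis by blast
    next
      case home
      have "u \<noteq> v'"
      proof
        assume "u = v'"
        with home have "g w = f' w" if "w \<in> ?A" for w using that by (auto simp: disagree_def)
        \<comment> \<open>Agreement on \<open>?A\<close> suffices because both functions are
          extensional.\<close>
        then have "g = f'"
          using g assms(2) by (intro PiE_ext[of g ?A "\<lambda>_. pverts H"]) (auto simp: wreath_verts_def)
        with \<open>u = v'\<close> ne x show False by simp
      qed
      \<comment> \<open>In both cases the tour term is 1 at \<open>u\<close> and 0 at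
        \<open>v'\<close>.\<close>
      moreover have "disagree ?A g f' = {} \<or> disagree ?A g f' = {v'}" using home(2) by blast
      ultimately have "tour u v' (disagree ?A g f') = Suc (tour v' v' (disagree ?A g f'))"
        by (elim disjE) (simp_all add: tour_def)
      with jump \<open>u \<noteq> v'\<close> v' show ?thesis by metis
    qed
  qed
  moreover have "gdist (with_proj H) (f w) (f' w) = real (?d (f w) (f' w))" if "w \<in> ?A" for w
  proof -
    have "f w \<in> pverts H" using assms(1) that by (auto simp: wreath_verts_def)
    then show ?thesis
      unfolding hop_dist_def
      by (intro gdist_eq_Least reachable_H f' that) unfold_locales
  qed
  ultimately show ?thesis by (simp add: \<phi>_def)
qed

end

section \<open>Sums over pairs of functions\<close>

lemma sum_rotate:
  "(\<Sum>x \<in> A. \<Sum>y \<in> B. \<Sum>z \<in> C. g x y z) = (\<Sum>z \<in> C. \<Sum>x \<in> A. \<Sum>y \<in> B. g x y z)"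
proof -
  have "(\<Sum>x \<in> A. \<Sum>y \<in> B. \<Sum>z \<in> C. g x y z) = (\<Sum>x \<in> A. \<Sum>z \<in> C. \<Sum>y \<in> B. g x y z)"
    by (intro sum.cong refl sum.swap)
  also have "\<dots> = (\<Sum>z \<in> C. \<Sum>x \<in> A. \<Sum>y \<in> B. g x y z)" by (rule sum.swap)
  finally show ?thesis .
qed

text \<open>Write \<open>g (f w)\<close> as a product over all coordinates with factor 1 off
  \<open>w\<close>, and exchange product and sum. Each of the other \<open>card A - 1\<close>
  coordinates then contributes \<open>card B\<close>.\<close>

lemma sum_PiE_coordinate:
  fixes g :: "'b \<Rightarrow> 'c :: comm_semiring_1"
  assumes "finite A" "finite B" "w \<in> A"
  shows "(\<Sum>f \<in> A \<rightarrow>\<^sub>E B. g (f w)) = of_nat (card B) ^ (card A - 1) * (\<Sum>x \<in> B. g x)"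
proof -
  let ?h = "\<lambda>u x. if u = w then g x else 1"
  have "(\<Sum>f \<in> A \<rightarrow>\<^sub>E B. g (f w)) = (\<Sum>f \<in> A \<rightarrow>\<^sub>E B. \<Prod>u \<in> A. ?h u (f u))"
    using assms by (intro sum.cong) (simp_all add: prod.delta)
  also have "\<dots> = (\<Prod>u \<in> A. \<Sum>x \<in> B. ?h u x)"
    by (rule prod_sum_PiE[symmetric]) (use assms in auto)
  also have "\<dots> = (\<Sum>x \<in> B. g x) * (\<Prod>u \<in> A - {w}. \<Sum>x \<in> B. ?h u x)"
    using assms by (subst prod.remove[of A w]) auto
  also have "(\<Prod>u \<in> A - {w}. \<Sum>x \<in> B. ?h u x) = of_nat (card B) ^ (card A - 1)"
    using assms by (simp add: prod.cong[of "A - {w}" "A - {w}" _ "\<lambda>_. of_nat (card B)"])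
  finally show ?thesis by (simp add: mult.commute)
qed

lemma sum_PiE_coordinate_pair:
  fixes g :: "'b \<Rightarrow> 'b \<Rightarrow> real"
  assumes "finite A" "finite B" "w \<in> A"
  shows "(\<Sum>f \<in> A \<rightarrow>\<^sub>E B. \<Sum>f' \<in> A \<rightarrow>\<^sub>E B. g (f w) (f' w)) =
    (real (card B) ^ (card A - 1))\<^sup>2 * (\<Sum>x \<in> B. \<Sum>y \<in> B. g x y)"
  by (simp add: sum_PiE_coordinate[OF assms] sum_PiE_coordinate[OF assms, of "\<lambda>x. \<Sum>y \<in> B. g x y"]
      sum_distrib_left[symmetric] power2_eq_square mult.assoc)

text \<open>Such an \<open>f'\<close> is determined by its value at \<open>v\<close>, which is
  arbitrary in \<open>B\<close>; off \<open>A\<close>, extensionality fixes both functions.\<close>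

lemma card_disagree_subset_singleton:
  assumes "finite B" "v \<in> A" "f \<in> A \<rightarrow>\<^sub>E B"
  shows "card {f' \<in> A \<rightarrow>\<^sub>E B. disagree A f f' \<subseteq> {v}} = card B"
proof -
  have "{f' \<in> A \<rightarrow>\<^sub>E B. disagree A f f' \<subseteq> {v}} = (\<lambda>x. f(v := x)) ` B"
  proof (intro equalityI subsetI)
    fix f' assume f': "f' \<in> {f' \<in> A \<rightarrow>\<^sub>E B. disagree A f f' \<subseteq> {v}}"
    have "f' u = (f(v := f' v)) u" for u
      using f' assms by (cases "u \<in> A") (auto simp: disagree_def PiE_iff extensional_def)
    then have "f' = f(v := f' v)" by (rule ext)
    moreover have "f' v \<in> B" using f' assms by auto
    ultimately show "f' \<in> (\<lambda>x. f(v := x)) ` B" by (rule image_eqI)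
  qed (use assms in \<open>auto simp: disagree_def PiE_iff extensional_def split: if_splits\<close>)
  moreover have "inj_on (\<lambda>x. f(v := x)) B" by (intro inj_onI) (metis fun_upd_same)
  ultimately show ?thesis by (simp add: card_image)
qed

text \<open>The cardinality is a sum of indicators, each depending on a single coordinate
  \<open>w\<close>; the last factor counts ordered pairs of distinct elements of
  \<open>B\<close>.\<close>

lemma sum_card_disagree:
  fixes A :: "'a set" and B :: "'b set"
  assumes "finite A" "finite B"
  shows "(\<Sum>f \<in> A \<rightarrow>\<^sub>E B. \<Sum>f' \<in> A \<rightarrow>\<^sub>E B. real (card (disagree A f f' - C))) =
    real (card (A - C)) * (real (card B) ^ (card A - 1))\<^sup>2 * (real (card B) * (real (card B) - 1))"
proof -
  let ?F = "A \<rightarrow>\<^sub>E B"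
  have card: "real (card (disagree A f f' - C)) = (\<Sum>w \<in> A - C. of_bool (f w \<noteq> f' w))"
    for f f' :: "'a \<Rightarrow> 'b"
  proof -
    have "disagree A f f' - C = {w \<in> A - C. f w \<noteq> f' w}" by (auto simp: disagree_def)
    then show ?thesis using assms(1) by (simp add: sum_of_bool_eq Int_def)
  qed
  have off_diagonal: "(\<Sum>x \<in> B. \<Sum>y \<in> B. of_bool (x \<noteq> y)) = real (card B) * (real (card B) - 1)"
  proof -
    have "(\<Sum>y \<in> B. of_bool (x \<noteq> y)) = real (card B) - 1" if "x \<in> B" for x
    proof -
      have "(\<Sum>y \<in> B. of_bool (x \<noteq> y)) = (\<Sum>y \<in> B. 1 - (if y = x then 1 else 0 :: real))"
        by (intro sum.cong) auto
      then show ?thesis using assms(2) that by (simp add: sum_subtractf)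
    qed
    then show ?thesis by simp
  qed
  have "(\<Sum>f \<in> ?F. \<Sum>f' \<in> ?F. real (card (disagree A f f' - C))) =
    (\<Sum>w \<in> A - C. \<Sum>f \<in> ?F. \<Sum>f' \<in> ?F. of_bool (f w \<noteq> f' w))"
    unfolding card by (rule sum_rotate)
  also have "\<dots> = (\<Sum>w \<in> A - C.
      (real (card B) ^ (card A - 1))\<^sup>2 * (\<Sum>x \<in> B. \<Sum>y \<in> B. of_bool (x \<noteq> y)))"
    by (intro sum.cong refl sum_PiE_coordinate_pair) (use assms in auto)
  finally show ?thesis by (simp add: off_diagonal)
qed

text \<open>For distinct endpoints the extra step is always present, so it contributes the number of
  pairs of functions.\<close>

lemma sum_tour_distinct:
  assumes "finite A" "finite B" "v \<in> A" "v' \<in> A" "v \<noteq> v'"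
  shows "(\<Sum>f \<in> A \<rightarrow>\<^sub>E B. \<Sum>f' \<in> A \<rightarrow>\<^sub>E B. real (tour v v' (disagree A f f'))) =
    (real (card A) - 2) * (real (card B) ^ (card A - 1))\<^sup>2 * (real (card B) * (real (card B) - 1))
    + (real (card B) ^ card A)\<^sup>2"
proof -
  \<comment> \<open>This bound lets the natural subtraction \<open>card A - 2\<close> pass to the
    reals.\<close>
  have "card {v, v'} \<le> card A" using assms by (intro card_mono) auto
  then have "real (card (A - {v, v'})) = real (card A) - 2"
    using assms by (simp add: card_Diff_subset)
  then show ?thesis
    using assms
    by (simp add: tour_def sum.distrib sum_card_disagree card_PiE power2_eq_square)
qed

text \<open>For a closed walk the extra step is absent exactly when \<open>f\<close> and
  \<open>f'\<close> agree off \<open>v\<close>, which for each \<open>f\<close> holds for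
  \<open>card B\<close> choices of \<open>f'\<close>.\<close>

lemma sum_tour_same:
  assumes "finite A" "finite B" "v \<in> A"
  shows "(\<Sum>f \<in> A \<rightarrow>\<^sub>E B. \<Sum>f' \<in> A \<rightarrow>\<^sub>E B. real (tour v v (disagree A f f'))) =
    (real (card A) - 1) * (real (card B) ^ (card A - 1))\<^sup>2 * (real (card B) * (real (card B) - 1))
    + real (card B) ^ card A * (real (card B) ^ card A - real (card B))"
proof -
  let ?F = "A \<rightarrow>\<^sub>E B"
  have F: "finite ?F" "card ?F = card B ^ card A" using assms by (auto simp: finite_PiE card_PiE)
  have "card A > 0" using assms by (auto simp: card_gt_0_iff)
  then have "real (card (A - {v, v})) = real (card A) - 1" using assms by simp
  moreover have "(\<Sum>f' \<in> ?F. of_bool (\<not> disagree A f f' \<subseteq> {v})) =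
      real (card B) ^ card A - real (card B)" if "f \<in> ?F" for f
  proof -
    have "(\<Sum>f' \<in> ?F. of_bool (\<not> disagree A f f' \<subseteq> {v})) =
        (\<Sum>f' \<in> ?F. 1 - of_bool (disagree A f f' \<subseteq> {v}) :: real)"
      by (intro sum.cong) auto
    also have "\<dots> = real (card ?F) - real (card {f' \<in> ?F. disagree A f f' \<subseteq> {v}})"
      using F(1) by (simp add: sum_subtractf sum_of_bool_eq Int_def)
    finally show ?thesis
      using card_disagree_subset_singleton[OF assms(2,3) that] F(2) by simp
  qed
  then have "(\<Sum>f \<in> ?F. \<Sum>f' \<in> ?F. of_bool (\<not> disagree A f f' \<subseteq> {v})) =
      real (card B) ^ card A * (real (card B) ^ card A - real (card B))"
    using F by simp
  ultimately show ?thesis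
    using sum_card_disagree[OF assms(1,2), of "{v, v}"]
    by (simp add: tour_def sum.distrib)
qed

section \<open>Evaluation of the Wiener index\<close>

theorem theorem5p10:
  fixes K :: "'a pair_pre_digraph" and H :: "'b pair_pre_digraph" and n m :: nat
  assumes "n \<ge> 2"
    and "complete_digraph n (with_proj K)"
    and "pair_graph H"
    and "Digraph_Component.connected (with_proj H)"
    and "card (pverts H) = m"
  shows "wiener_index (with_proj (wreath_product K H)) =
    real n ^ 3 * real m ^ (2 * n - 2) * wiener_index (with_proj H)
    + real n * real m ^ n / 2 *
      (real n ^ 2 * real m ^ n - real n ^ 2 * real m ^ (n - 1) - real m ^ n * real n
        + 2 * real m ^ (n - 1) * real n - real m + real m ^ n - real m ^ (n - 1))"
proof -
  have K: "pair_graph K" "card (pverts K) = n"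
      "parcs K = {(u, v). u \<in> pverts K \<and> v \<in> pverts K \<and> u \<noteq> v}"
    using assms(2) by (auto simp: complete_digraph_def intro: pair_graphI_graph)
  have "strongly_connected (with_proj H)"
  proof -
    interpret H: pair_graph H by fact
    show ?thesis by (rule H.symmetric_connected_imp_strongly_connected[OF H.pair_sym_arcs assms(4)])
  qed
  then interpret wreath_complete K H by (intro wreath_complete.intro K assms(3))
  let ?A = "pverts K" and ?B = "pverts H" and ?F = "pverts K \<rightarrow>\<^sub>E pverts H"
  let ?d = "gdist (with_proj H)"
  let ?t = "\<lambda>f f' v v'. real (tour v v' (disagree ?A f f'))"
  \<comment> \<open>Every power of \<open>m\<close> in the claim is expressed through
    \<open>m\<close> and \<open>q\<close>, which turns the final identity into a polynomial
    one.\<close>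
  define q where "q = real m ^ (n - 1)"
  define S where "S = (\<Sum>x \<in> ?B. \<Sum>y \<in> ?B. ?d x y)"
  have pow: "real m ^ n = real m * q" "real m ^ (2 * n - 2) = q\<^sup>2"
  proof -
    obtain k where "n = Suc k" using \<open>n \<ge> 2\<close> by (cases n) auto
    then show "real m ^ n = real m * q" "real m ^ (2 * n - 2) = q\<^sup>2"
      by (simp_all add: q_def mult.commute flip: power_mult)
  qed
  have finB: "finite ?B" by simp
  have D: "(\<Sum>f \<in> ?F. \<Sum>f' \<in> ?F. \<Sum>w \<in> ?A. ?d (f w) (f' w)) = real n * (q\<^sup>2 * S)"
  proof -
    have "(\<Sum>f \<in> ?F. \<Sum>f' \<in> ?F. \<Sum>w \<in> ?A. ?d (f w) (f' w)) =
        (\<Sum>w \<in> ?A. \<Sum>f \<in> ?F. \<Sum>f' \<in> ?F. ?d (f w) (f' w))"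
      by (rule sum_rotate)
    also have "\<dots> = (\<Sum>w \<in> ?A. q\<^sup>2 * S)"
      using sum_PiE_coordinate_pair[OF finite_K finB] K(2) assms(5)
      by (intro sum.cong) (simp_all add: q_def S_def)
    finally show ?thesis using K(2) by simp
  qed
  \<comment> \<open>\<open>T1\<close> and \<open>T2\<close> are the total tour lengths over all
    pairs of functions, for equal and for distinct endpoints.\<close>
  define T1 where "T1 = (real n - 1) * q\<^sup>2 * (real m * (real m - 1)) + real m * q * (real m * q - real m)"
  define T2 where "T2 = (real n - 2) * q\<^sup>2 * (real m * (real m - 1)) + (real m * q)\<^sup>2"
  \<comment> \<open>Written as a correction of \<open>T2\<close> on the diagonal, so that summing
    over \<open>v'\<close> needs no case split.\<close>
  have T: "(\<Sum>f \<in> ?F. \<Sum>f' \<in> ?F. ?t f f' v v') = (if v' = v then T1 - T2 else 0) + T2"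
    if "v \<in> ?A" "v' \<in> ?A" for v v'
    using that sum_tour_same[OF finite_K finB, of v] sum_tour_distinct[OF finite_K finB, of v v']
    by (simp add: K(2) assms(5) pow(1) T1_def T2_def q_def)
  have "(\<Sum>x \<in> wreath_verts K H. \<Sum>y \<in> wreath_verts K H. gdist (with_proj (wreath_product K H)) x y)
      = (\<Sum>(f, v) \<in> wreath_verts K H. \<Sum>(f', v') \<in> wreath_verts K H.
          (\<Sum>w \<in> ?A. ?d (f w) (f' w)) + ?t f f' v v')"
    by (intro sum.cong refl) (auto simp: gdist_wreath intro!: sum.cong)
  also have "\<dots> = (\<Sum>f \<in> ?F. \<Sum>v \<in> ?A. \<Sum>f' \<in> ?F. \<Sum>v' \<in> ?A.
          (\<Sum>w \<in> ?A. ?d (f w) (f' w)) + ?t f f' v v')"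
    by (simp add: wreath_verts_def flip: sum.cartesian_product)
  \<comment> \<open>The endpoints are moved outwards, so that \<open>D\<close> and \<open>T\<close>
    apply to the inner sums over pairs of functions.\<close>
  also have "\<dots> = (\<Sum>v \<in> ?A. \<Sum>f \<in> ?F. \<Sum>v' \<in> ?A. \<Sum>f' \<in> ?F.
          (\<Sum>w \<in> ?A. ?d (f w) (f' w)) + ?t f f' v v')"
    by (subst sum.swap) (intro sum.cong refl sum.swap)
  also have "\<dots> = (\<Sum>v \<in> ?A. \<Sum>v' \<in> ?A. \<Sum>f \<in> ?F. \<Sum>f' \<in> ?F.
          (\<Sum>w \<in> ?A. ?d (f w) (f' w)) + ?t f f' v v')"
    by (intro sum.cong refl sum.swap)
  also have "\<dots> = (\<Sum>v \<in> ?A. \<Sum>v' \<in> ?A. real n * (q\<^sup>2 * S) + ((if v' = v then T1 - T2 else 0) + T2))"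
    by (intro sum.cong refl) (simp add: sum.distrib D T)
  also have "\<dots> = real n * (real n * (real n * (q\<^sup>2 * S)) + (T1 - T2) + real n * T2)"
    using finite_K by (simp add: sum.distrib K(2))
  finally have "wiener_index (with_proj (wreath_product K H)) =
      1 / 2 * (real n * (real n * (real n * (q\<^sup>2 * S)) + (T1 - T2) + real n * T2))"
    by (simp add: wiener_index_def wreath_product_def)
  moreover have "wiener_index (with_proj H) = 1 / 2 * S"
    by (simp add: wiener_index_def S_def)
  ultimately show ?thesis
    unfolding pow q_def[symmetric] T1_def T2_def
    by (simp add: field_simps power2_eq_square power3_eq_cube)
qed

end
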